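(* If $n$, $r$ and $t$ are positive integers with $n\geq r\geq 2t$, then $$\chi(U_t(n,r))\leq\left\lceil\frac{r^2}{t}(\ln n+1)\right\rceil,$$ where $\chi$ denotes the chromatic number and $U_t(n,r)$ is the local Kneser graph.
   Context: Notation: $[n]=\{1,2,\ldots,n\}$; $\ln$ is the natural logarithm. For positive integers $n,r,t$ with $n\geq r\geq 2t$, the local Kneser graph $U_t(n,r)$ is the finite simple graph whose vertices are all ordered pairs $(A,B)$ with $A,B\subseteq[n]$, $|A|=t$, $|B|=r-t$ and $A\cap B=\varnothing$; two vertices $(A,B)$ and $(C,D)$ are adjacent if and only if $A\subseteq D$ and $C\subseteq B$. *)

theory Defs
  imports Complex_Main "Graph_Theory.Pair_Digraph"
begin

text \<open>
  Finite simple graphs are rendered by the locale \<open>pair_graph\<close>, which describes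
  finite digraphs without loops whose arc set, a set of ordered pairs of vertices, is symmetric.
\<close>

definition proper_coloring :: "'a pair_pre_digraph \<Rightarrow> 'c set \<Rightarrow> ('a \<Rightarrow> 'c) \<Rightarrow> bool" where
  "proper_coloring G K c \<longleftrightarrow>
     c ` pverts G \<subseteq> K \<and> (\<forall>u\<in>pverts G. \<forall>v\<in>pverts G. (u, v) \<in> parcs G \<longrightarrow> c u \<noteq> c v)"

text \<open>
  The least number is meaningful whenever some finite proper colouring exists, in particular
  for every finite simple graph (see \<open>pair_graph_colorable\<close>).
\<close>

definition chromatic_number :: "'a pair_pre_digraph \<Rightarrow> nat" where
  "chromatic_number G = (LEAST k. \<exists>c :: 'a \<Rightarrow> nat. proper_coloring G {..<k} c)"

definition local_kneser_graph :: "nat \<Rightarrow> nat \<Rightarrow> nat \<Rightarrow> (nat set \<times> nat set) pair_pre_digraph" where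
  "local_kneser_graph t n r =
     (let V = {(A, B). A \<subseteq> {1..n} \<and> B \<subseteq> {1..n} \<and> card A = t \<and> card B = r - t \<and> A \<inter> B = {}}
      in \<lparr>pverts = V,
          parcs = {((A, B), (C, D)). (A, B) \<in> V \<and> (C, D) \<in> V \<and> A \<subseteq> D \<and> C \<subseteq> B}\<rparr>)"

lemma pair_graph_colorable:
  assumes "pair_graph G"
  shows "\<exists>k. \<exists>c :: 'a \<Rightarrow> nat. proper_coloring (G :: 'a pair_pre_digraph) {..<k} c"
proof -
  interpret pair_graph G by (rule assms)
  obtain c :: "'a \<Rightarrow> nat" where c: "inj_on c (pverts G)" "c ` pverts G = {i. i < card (pverts G)}"
    using finite_imp_inj_to_nat_seg[of "pverts G"] pair_finite_verts
    by (metis card_Collect_less_nat card_image)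
  have "proper_coloring G {..<card (pverts G)} c"
    unfolding proper_coloring_def
    using c pair_no_loops by (fastforce dest: inj_onD)
  then show ?thesis by blast
qed

lemma pair_graph_local_kneser_graph:
  assumes "t > 0"
  shows "pair_graph (local_kneser_graph t n r)"
proof -
  have "pverts (local_kneser_graph t n r) \<subseteq> Pow {1..n} \<times> Pow {1..n}"
    by (auto simp: local_kneser_graph_def Let_def)
  then have fin: "finite (pverts (local_kneser_graph t n r))"
    by (rule finite_subset) simp
  have sub: "parcs (local_kneser_graph t n r) \<subseteq>
      pverts (local_kneser_graph t n r) \<times> pverts (local_kneser_graph t n r)"
    by (auto simp: local_kneser_graph_def Let_def)
  have loop: "False" if "((A, B), (A, B)) \<in> parcs (local_kneser_graph t n r)" for A B
  proof -
    from that have "A \<subseteq> B" "A \<inter> B = {}" "card A = t"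
      by (auto simp: local_kneser_graph_def Let_def)
    then show False using assms by (auto simp: inf.absorb1)
  qed
  have sym: "sym (parcs (local_kneser_graph t n r))"
    by (auto simp: local_kneser_graph_def Let_def sym_def)
  show ?thesis
    by (unfold_locales) (use fin sub loop sym finite_subset[OF sub] in
      \<open>auto simp: symmetric_def arcs_ends_def with_proj_def sym_def arc_to_ends_def\<close>)
qed

end

theory Submission
  imports Defs "HOL-Combinatorics.Permutations"
begin

text \<open>
  For a linear order of \<open>{1..n}\<close>, the vertices \<open>(A, B)\<close> such that the least element of
  \<open>A \<union> B\<close> lies in \<open>A\<close> form an independent set: if \<open>(A, B)\<close> and \<open>(C, D)\<close> are adjacent vertices
  of this kind, then the least element of \<open>A \<union> B\<close> lies in \<open>D\<close> and that of \<open>C \<union> D\<close> lies in \<open>B\<close>, so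
  each of the two precedes the other. A given vertex belongs to the class of a uniformly random
  order with probability \<open>t / r\<close>. There are at most \<open>n ^ r\<close> vertices, so \<open>k\<close> well-chosen orders
  leave at most \<open>n ^ r * (1 - t / r) ^ k < 1\<close> of them uncovered as soon as
  \<open>k \<ge> r\<^sup>2 / t * (ln n + 1)\<close>.
\<close>

text \<open>Double counting: at least \<open>q * card \<Omega> * card U\<close> pairs
  \<open>(w, v)\<close> satisfy \<open>P w v\<close>, so some \<open>w\<close> accounts for at least
  the mean share.\<close>

lemma exists_ge_average_cover:
  fixes q :: real
  assumes "finite U" "finite \<Omega>" "\<Omega> \<noteq> {}"
    and q: "\<And>v. v \<in> U \<Longrightarrow> q * real (card \<Omega>) \<le> real (card {w \<in> \<Omega>. P w v})"
  obtains w where "w \<in> \<Omega>" "q * real (card U) \<le> real (card {v \<in> U. P w v})"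
proof (rule ccontr)
  assume "\<not> thesis"
  with that have "\<And>w. w \<in> \<Omega> \<Longrightarrow> real (card {v \<in> U. P w v}) < q * real (card U)"
    by force
  then have "(\<Sum>w\<in>\<Omega>. real (card {v \<in> U. P w v})) < (\<Sum>w\<in>\<Omega>. q * real (card U))"
    using assms(2,3) by (intro sum_strict_mono) auto
  also have "\<dots> = (\<Sum>v\<in>U. q * real (card \<Omega>))"
    by simp
  also have "\<dots> \<le> (\<Sum>v\<in>U. real (card {w \<in> \<Omega>. P w v}))"
    by (intro sum_mono q)
  also have "\<dots> = (\<Sum>w\<in>\<Omega>. real (card {v \<in> U. P w v}))"
    using sum.swap_restrict[OF assms(1,2), of "\<lambda>_ _. 1::real" "\<lambda>v w. P w v"] by simp
  finally show False by simp
qed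

text \<open>Averaging over the elements still uncovered, rather than over all of \<open>V\<close>,
  gives a next choice that shrinks this set by a factor of at most \<open>1 - q\<close>.\<close>

lemma greedy_cover:
  fixes q :: real
  assumes "finite V" "finite \<Omega>" "\<Omega> \<noteq> {}" "q \<le> 1"
    and q: "\<And>v. v \<in> V \<Longrightarrow> q * real (card \<Omega>) \<le> real (card {w \<in> \<Omega>. P w v})"
  shows "\<exists>f. f ` {..<k} \<subseteq> \<Omega> \<and>
           real (card {v \<in> V. \<forall>i<k. \<not> P (f i) v}) \<le> real (card V) * (1 - q) ^ k"
proof (induction k)
  case 0
  show ?case by simp
next
  case (Suc k)
  then obtain f where f: "f ` {..<k} \<subseteq> \<Omega>"
    and bound: "real (card {v \<in> V. \<forall>i<k. \<not> P (f i) v}) \<le> real (card V) * (1 - q) ^ k"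
    by blast
  define U where "U = {v \<in> V. \<forall>i<k. \<not> P (f i) v}"
  have "finite U" "U \<subseteq> V"
    using assms(1) by (auto simp: U_def)
  then obtain w where w: "w \<in> \<Omega>" "q * real (card U) \<le> real (card {v \<in> U. P w v})"
    using exists_ge_average_cover[of U \<Omega> q P] assms by blast
  have "{v \<in> V. \<forall>i<Suc k. \<not> P ((f(k := w)) i) v} = U - {v \<in> U. P w v}"
    by (auto simp: U_def less_Suc_eq)
  moreover have "real (card (U - {v \<in> U. P w v})) = real (card U) - real (card {v \<in> U. P w v})"
    using \<open>finite U\<close> by (simp add: card_Diff_subset card_mono of_nat_diff)
  moreover have "\<dots> \<le> (1 - q) * real (card U)"
    using w(2) by (simp add: algebra_simps)
  moreover have "\<dots> \<le> (1 - q) * (real (card V) * (1 - q) ^ k)"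
    using bound \<open>q \<le> 1\<close> by (intro mult_left_mono) (auto simp: U_def)
  ultimately have "real (card {v \<in> V. \<forall>i<Suc k. \<not> P ((f(k := w)) i) v})
      \<le> real (card V) * (1 - q) ^ Suc k"
    by (simp add: mult_ac)
  moreover have "(f(k := w)) ` {..<Suc k} \<subseteq> \<Omega>"
    using f w(1) by (auto simp: less_Suc_eq)
  ultimately show ?case by blast
qed

text \<open>A permutation encodes a linear order, with \<open>p y\<close> as the rank of
  \<open>y\<close>. In use, \<open>R\<close> is the union \<open>A \<union> B\<close> of a
  vertex.\<close>

definition minimizing_perms :: "nat set \<Rightarrow> nat set \<Rightarrow> nat \<Rightarrow> (nat \<Rightarrow> nat) set" where
  "minimizing_perms S R x = {p. p permutes S \<and> (\<forall>y\<in>R. p x \<le> p y)}"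

text \<open>Precomposing with the transposition hands the least rank from \<open>x\<close> to
  \<open>y\<close> and only rearranges the ranks within \<open>R\<close>.\<close>

lemma minimizing_perms_transpose:
  assumes "R \<subseteq> S" "x \<in> R" "y \<in> R" "p \<in> minimizing_perms S R x"
  shows "p \<circ> transpose x y \<in> minimizing_perms S R y"
  using assms permutes_compose[OF permutes_swap_id[of x S y], of p]
  by (auto simp: minimizing_perms_def transpose_def)

lemma card_minimizing_perms_eq:
  assumes "R \<subseteq> S" "x \<in> R" "y \<in> R"
  shows "card (minimizing_perms S R x) = card (minimizing_perms S R y)"
proof (rule bij_betw_same_card)
  show "bij_betw (\<lambda>p. p \<circ> transpose x y) (minimizing_perms S R x) (minimizing_perms S R y)"
    \<comment> \<open>A transposition is an involution, so the same map serves as the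
      inverse.\<close>
    by (rule bij_betw_byWitness[where f' = "\<lambda>p. p \<circ> transpose x y"])
      (use assms minimizing_perms_transpose[of R S x y] minimizing_perms_transpose[of R S y x]
        in \<open>auto simp: o_assoc[symmetric] transpose_commute[of y x]\<close>)
qed

lemma minimizing_perms_disjoint:
  assumes "x \<in> R" "y \<in> R" "x \<noteq> y"
  shows "minimizing_perms S R x \<inter> minimizing_perms S R y = {}"
  using assms by (force simp: minimizing_perms_def dest: permutes_inj injD)

lemma Union_minimizing_perms:
  assumes "finite R" "R \<noteq> {}"
  shows "(\<Union>x\<in>R. minimizing_perms S R x) = {p. p permutes S}"
proof -
  have "\<exists>x\<in>R. \<forall>y\<in>R. p x \<le> p y" for p :: "nat \<Rightarrow> nat"
    using assms ex_is_arg_min_if_finite[of R p] by (auto simp: is_arg_min_linorder)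
  then show ?thesis by (auto simp: minimizing_perms_def)
qed

text \<open>The classes of distinct elements are disjoint and, by the transposition symmetry,
  equally large. Fixing one \<open>x\<close> as reference lets \<open>A\<close> and all of
  \<open>R\<close> be compared by a common factor.\<close>

lemma card_Union_minimizing_perms:
  assumes "finite S" "R \<subseteq> S" "A \<subseteq> R" "x \<in> R"
  shows "card (\<Union>a\<in>A. minimizing_perms S R a) = card A * card (minimizing_perms S R x)"
proof -
  have fin: "finite (minimizing_perms S R a)" for a
    using finite_permutations[OF assms(1)] by (simp add: minimizing_perms_def)
  have "card (\<Union>a\<in>A. minimizing_perms S R a) = (\<Sum>a\<in>A. card (minimizing_perms S R a))"
    using assms finite_subset[of A S] fin minimizing_perms_disjoint[of _ R _ S]
    by (intro card_UN_disjoint) blast+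
  also have "\<dots> = (\<Sum>a\<in>A. card (minimizing_perms S R x))"
    using assms by (intro sum.cong refl card_minimizing_perms_eq[of R]) auto
  finally show ?thesis by simp
qed

definition min_in_first :: "(nat \<Rightarrow> nat) \<Rightarrow> nat set \<times> nat set \<Rightarrow> bool" where
  "min_in_first p v \<longleftrightarrow> (\<exists>a\<in>fst v. \<forall>y\<in>fst v \<union> snd v. p a \<le> p y)"

text \<open>This is the probability \<open>card A / (card A + card B)\<close> with denominators
  cleared. Both counts are multiples of the same class size, the second by taking all of
  \<open>A \<union> B\<close> in place of \<open>A\<close>.\<close>

lemma card_min_in_first:
  assumes "finite S" "A \<subseteq> S" "B \<subseteq> S" "A \<inter> B = {}" "A \<noteq> {}"
  shows "card A * card {p. p permutes S} =
           (card A + card B) * card {p \<in> {p. p permutes S}. min_in_first p (A, B)}"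
proof -
  obtain x where x: "x \<in> A" using assms by blast
  let ?R = "A \<union> B"
  have R: "finite ?R" "?R \<subseteq> S" using assms finite_subset by auto
  have "{p \<in> {p. p permutes S}. min_in_first p (A, B)} = (\<Union>a\<in>A. minimizing_perms S ?R a)"
    by (auto simp: min_in_first_def minimizing_perms_def)
  then have "card {p \<in> {p. p permutes S}. min_in_first p (A, B)}
      = card A * card (minimizing_perms S ?R x)"
    using card_Union_minimizing_perms[of S ?R A x] assms R x by simp
  moreover have "card {p. p permutes S} = card ?R * card (minimizing_perms S ?R x)"
    using card_Union_minimizing_perms[of S ?R ?R x] Union_minimizing_perms[of ?R S] assms R x
    by auto
  moreover have "card ?R = card A + card B"
    using assms R by (intro card_Un_disjoint) auto
  ultimately show ?thesis by simp
qed

lemma min_in_first_independent: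
  assumes "inj p" "A \<inter> B = {}" "A \<subseteq> D" "C \<subseteq> B"
    and "min_in_first p (A, B)" "min_in_first p (C, D)"
  shows False
proof -
  obtain a where a: "a \<in> A" "\<And>y. y \<in> A \<union> B \<Longrightarrow> p a \<le> p y"
    using assms(5) by (auto simp: min_in_first_def)
  obtain c where c: "c \<in> C" "\<And>y. y \<in> C \<union> D \<Longrightarrow> p c \<le> p y"
    using assms(6) by (auto simp: min_in_first_def)
  \<comment> \<open>Adjacency puts \<open>a\<close> in \<open>D\<close> and \<open>c\<close> in
    \<open>B\<close>, so each minimum bounds the other. Injectivity then yields a common element of
    \<open>A\<close> and \<open>B\<close>.\<close>
  have "p a = p c"
    using a c assms(3,4) by (intro antisym) auto
  then have "a = c"
    using \<open>inj p\<close> by (simp add: inj_eq)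
  then show False
    using a c assms(2,4) by auto
qed

lemma pverts_local_kneser_graph:
  "pverts (local_kneser_graph t n r) =
     {(A, B). A \<subseteq> {1..n} \<and> B \<subseteq> {1..n} \<and> card A = t \<and> card B = r - t \<and> A \<inter> B = {}}"
  by (simp add: local_kneser_graph_def)

lemma card_pverts_local_kneser_graph_le:
  assumes "t \<le> r" "r \<le> n"
  shows "card (pverts (local_kneser_graph t n r)) \<le> n ^ r"
proof -
  let ?X = "{A. A \<subseteq> {1..n} \<and> card A = t}" and ?Y = "{B. B \<subseteq> {1..n} \<and> card B = r - t}"
  have "card (pverts (local_kneser_graph t n r)) \<le> card (?X \<times> ?Y)"
    by (rule card_mono) (auto simp: pverts_local_kneser_graph)
  also have "\<dots> = (n choose t) * (n choose (r - t))"
    using n_subsets[of "{1..n}"] by (simp add: card_cartesian_product)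
  also have "\<dots> \<le> n ^ t * n ^ (r - t)"
    using assms by (intro mult_mono binomial_le_pow) auto
  also have "\<dots> = n ^ r"
    using assms by (simp flip: power_add)
  finally show ?thesis .
qed

text \<open>The classes \<open>P i\<close> may overlap; choosing for each vertex one index of a
  class containing it gives a proper colouring.\<close>

lemma chromatic_number_le_of_cover:
  assumes "\<And>v. v \<in> pverts G \<Longrightarrow> \<exists>i<k. P i v"
    and "\<And>i u v. i < k \<Longrightarrow> (u, v) \<in> parcs G \<Longrightarrow> P i u \<Longrightarrow> P i v \<Longrightarrow> False"
  shows "chromatic_number G \<le> k"
proof -
  obtain c where c: "\<And>v. v \<in> pverts G \<Longrightarrow> c v < k \<and> P (c v) v"
    using assms(1) by metis
  have "proper_coloring G {..<k} c"
    unfolding proper_coloring_def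
  proof (intro conjI ballI impI notI)
    show "c ` pverts G \<subseteq> {..<k}" using c by auto
    fix u v assume uv: "u \<in> pverts G" "v \<in> pverts G" "(u, v) \<in> parcs G" "c u = c v"
    then show False using c[of u] c[of v] assms(2)[of "c u" u v] by simp
  qed
  then show ?thesis
    unfolding chromatic_number_def by (intro Least_le exI)
qed

text \<open>By \<open>1 - x \<le> exp (- x)\<close> with \<open>x = t / r\<close>, the left side is
  at most \<open>exp (r * ln n - k * t / r)\<close>. The bound on \<open>k\<close> cancels
  \<open>r * ln n\<close> and leaves at most \<open>exp (- r)\<close>.\<close>

lemma power_one_minus_less_one:
  fixes n r t k :: nat
  assumes "n > 0" "t > 0" "t \<le> r" and k: "(real r)\<^sup>2 / real t * (ln (real n) + 1) \<le> real k"
  shows "real (n ^ r) * (1 - real t / real r) ^ k < 1"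
proof -
  have "real r * (ln (real n) + 1) = (real t / real r) * ((real r)\<^sup>2 / real t * (ln (real n) + 1))"
    using assms by (simp add: field_simps power2_eq_square)
  also have "\<dots> \<le> (real t / real r) * real k"
    by (intro mult_left_mono k) simp
  finally have exponent: "real r * ln (real n) - real k * (real t / real r) \<le> - real r"
    by (simp add: algebra_simps)
  have "(1 - real t / real r) ^ k \<le> exp (- (real t / real r)) ^ k"
    using assms exp_ge_add_one_self[of "- (real t / real r)"] by (intro power_mono) auto
  also have "\<dots> = exp (- (real k * (real t / real r)))"
    by (simp flip: exp_of_nat_mult)
  finally have "real (n ^ r) * (1 - real t / real r) ^ k
      \<le> exp (real r * ln (real n)) * exp (- (real k * (real t / real r)))"
    using assms(1) by (simp add: exp_of_nat_mult mult_left_mono)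
  also have "\<dots> = exp (real r * ln (real n) - real k * (real t / real r))"
    by (simp flip: exp_add)
  also have "\<dots> \<le> exp (- real r)"
    using exponent by simp
  also have "\<dots> < 1"
    using assms by simp
  finally show ?thesis .
qed

theorem theorem2:
  fixes n r t :: nat
  assumes "n > 0" and "r > 0" and "t > 0"
    and "n \<ge> r" and "r \<ge> 2 * t"
  shows "int (chromatic_number (local_kneser_graph t n r))
           \<le> \<lceil>(real r)\<^sup>2 / real t * (ln (real n) + 1)\<rceil>"
proof -
  let ?G = "local_kneser_graph t n r" and ?\<Omega> = "{p. p permutes {1..n}}"
  define k where "k = nat \<lceil>(real r)\<^sup>2 / real t * (ln (real n) + 1)\<rceil>"
  \<comment> \<open>This ensures that \<open>nat\<close> does not truncate, so that
    \<open>int k\<close> is exactly the ceiling.\<close>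
  have nonneg: "0 \<le> (real r)\<^sup>2 / real t * (ln (real n) + 1)"
    using assms by simp
  have k: "(real r)\<^sup>2 / real t * (ln (real n) + 1) \<le> real k"
    unfolding k_def by (rule real_nat_ceiling_ge)
  have fin: "finite (pverts ?G)"
    by (rule finite_subset[of _ "Pow {1..n} \<times> Pow {1..n}"]) (auto simp: pverts_local_kneser_graph)
  have prob: "real t / real r * real (card ?\<Omega>) \<le> real (card {p \<in> ?\<Omega>. min_in_first p v})"
    if vertex: "v \<in> pverts ?G" for v
  proof -
    obtain A B where v: "v = (A, B)" "A \<subseteq> {1..n}" "B \<subseteq> {1..n}" "A \<inter> B = {}"
        "card A = t" "card B = r - t"
      using vertex unfolding pverts_local_kneser_graph by blast
    then have "A \<noteq> {}"
      using \<open>t > 0\<close> by auto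
    with v have "t * card ?\<Omega> = r * card {p \<in> ?\<Omega>. min_in_first p v}"
      using card_min_in_first[of "{1..n}" A B] assms by auto
    then have "real t * real (card ?\<Omega>) = real r * real (card {p \<in> ?\<Omega>. min_in_first p v})"
      by (metis of_nat_mult)
    then show ?thesis
      using assms by (simp add: field_simps)
  qed
  have "?\<Omega> \<noteq> {}" "finite ?\<Omega>" "real t / real r \<le> 1"
    using finite_permutations[of "{1..n}"] assms by (auto intro: permutes_id)
  then obtain f where f: "f ` {..<k} \<subseteq> ?\<Omega>"
    and uncovered: "real (card {v \<in> pverts ?G. \<forall>i<k. \<not> min_in_first (f i) v})
        \<le> real (card (pverts ?G)) * (1 - real t / real r) ^ k"
    using greedy_cover[where P = min_in_first and k = k, OF fin _ _ _ prob] by blast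
  note uncovered
  also have "\<dots> \<le> real (n ^ r) * (1 - real t / real r) ^ k"
    using assms card_pverts_local_kneser_graph_le[of t r n]
    by (intro mult_right_mono) (auto simp del: of_nat_power)
  also have "\<dots> < 1"
    using assms k by (intro power_one_minus_less_one) auto
  \<comment> \<open>A cardinality below 1 is 0.\<close>
  finally have covered: "{v \<in> pverts ?G. \<forall>i<k. \<not> min_in_first (f i) v} = {}"
    using fin by simp
  have "chromatic_number ?G \<le> k"
  proof (rule chromatic_number_le_of_cover)
    show "\<exists>i<k. min_in_first (f i) v" if "v \<in> pverts ?G" for v
      using covered that by blast
    fix i u v
    assume "i < k" "(u, v) \<in> parcs ?G" "min_in_first (f i) u" "min_in_first (f i) v"
    moreover from \<open>i < k\<close> f have "inj (f i)"
      using permutes_inj by blast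
    ultimately show False
      using min_in_first_independent[of "f i"]
      by (fastforce simp: local_kneser_graph_def Let_def)
  qed
  then have "int (chromatic_number ?G) \<le> int k"
    by simp
  also have "\<dots> = \<lceil>(real r)\<^sup>2 / real t * (ln (real n) + 1)\<rceil>"
    using nonneg unfolding k_def by (simp add: ceiling_mono)
  finally show ?thesis .
qed

end
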